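(* Let $J\ge 0$ be an integer, $M=2^{J+1}$, $\omega\in(0,1)$, and let $F:\ell^2(\mathbb{R})\to\ell^2(\mathbb{R})$, the linear map $A_M:\mathbb{R}^M\to\mathbb{R}^M$, the map $T:\ell^2(\mathbb{R})\to\ell^2(\mathbb{R})$, $T(\mathbf{x})=\Pi_M\mathbf{x}-A_M\Pi_MF(\mathbf{x})+\Pi_\infty(\mathbf{x}-F(\mathbf{x}))$, and $\bar{\mathbf{c}}\in\mathbb{R}^M\subset\ell^2(\mathbb{R})$ be as in the context. Suppose that $Y_M,Y_\infty$ are real numbers and $Z_M(r),Z_\infty(r)$ are polynomials in $r$ such that $$\|\Pi_M(T(\bar{\mathbf{c}})-\bar{\mathbf{c}})\|_{\ell^2}\le Y_M,\qquad \|\Pi_\infty(T(\bar{\mathbf{c}})-\bar{\mathbf{c}})\|_{\ell^2}\le Y_\infty,$$ and, for all $r>0$, $$\sup_{x_1,x_2\in\overline{B(r)}}\|\Pi_M(DT(\bar{\mathbf{c}}+x_1)x_2)\|_{\ell^2}\le Z_M(r)\,r,\qquad \sup_{x_1,x_2\in\overline{B(r)}}\|\Pi_\infty(DT(\bar{\mathbf{c}}+x_1)x_2)\|_{\ell^2}\le Z_\infty(r)\,r .$$ Define the radii polynomials $$p_M(r):=Z_M(r)r-\omega r+Y_M,\qquad p_\infty(r):=Z_\infty(r)r-(1-\omega)r+Y_\infty .$$ If there exists $r_0>0$ such that $p_M(r_0)<0$ and $p_\infty(r_0)<0$, then there exists a unique $\tilde{\mathbf{c}}\in B_\omega(\bar{\mathbf{c}},r_0)$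 such that $T(\tilde{\mathbf{c}})=\tilde{\mathbf{c}}$.
   Context: $\ell^2(\mathbb{R})$ is the space of square-summable real sequences $(c_i)_{i\ge1}$. $\Pi_M\mathbf{c}=(c_1,\dots,c_M)$, identified with $(c_1,\dots,c_M,0,0,\dots)\in\ell^2(\mathbb{R})$, so that $\mathbb{R}^M\subset\ell^2(\mathbb{R})$; $\Pi_\infty=I-\Pi_M$. Haar wavelets on $[0,1]$: $\psi_1=\phi$ is $1$ on $[0,1)$ and $0$ otherwise; for $i=2^j+k+1$ with $j\ge0$, $0\le k\le 2^j-1$, $\psi_i=\psi_{j,k}$ equals $2^{j/2}$ on $[\frac{k}{2^j},\frac{k+0.5}{2^j})$, $-2^{j/2}$ on $[\frac{k+0.5}{2^j},\frac{k+1}{2^j})$ and $0$ otherwise. They form an orthonormal basis of $L^2([0,1])$. $w_i(t)=\int_0^t\psi_i(s)\,ds$, and $\mathcal{H}:L^2([0,1])\to\ell^2(\mathbb{R})$, $(\mathcal{H}f)_i=\int_0^1f\psi_i\,dt$, is the Haar transform. An initial value problem $\dot u=f(t,u)$, $u(0)=u_0$ is given, and $$F(\mathbf{c}):=\mathbf{c}-\mathcal{H}\Big(f\big(t,\textstyle\sum_{i=1}^\infty c_iw_i(t)+u_0\big)\Big),$$ which is assumed to be a well-defined, (Fréchet) differentiable map $\ell^2(\mathbb{R})\to\ell^2(\mathbb{R})$. $A_M:\mathbb{R}^M\to\mathbb{R}^M$ is a linear map (in practice a numerical approximation of the inverse of the Jacobian of $\Pi_MF$ restricted to $\mathbb{R}^M$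 at $\bar{\mathbf{c}}$), and $\bar{\mathbf{c}}\in\mathbb{R}^M$ is a given vector (in practice a numerical approximate zero of $F$). $DT(\mathbf{x})$ denotes the Fréchet derivative of $T$ at $\mathbf{x}$, $DT(\mathbf{x})=\Pi_M-A_M\Pi_MDF(\mathbf{x})+\Pi_\infty(I-DF(\mathbf{x}))$. Neighborhoods: $\overline{B(r)}=\{\mathbf{y}\in\ell^2(\mathbb{R}):\|\mathbf{y}\|_{\ell^2}\le r\}$; $\overline{B_\omega(\bar{\mathbf{c}},r)}=\{\mathbf{y}\in\ell^2(\mathbb{R}):\|\Pi_M(\mathbf{y}-\bar{\mathbf{c}})\|_{\ell^2}\le\omega r,\ \|\Pi_\infty(\mathbf{y}-\bar{\mathbf{c}})\|_{\ell^2}\le(1-\omega)r\}$, and $B_\omega(\bar{\mathbf{c}},r)$ is the corresponding open set, defined with strict inequalities. *)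

theory Defs
  imports
    "HOL-Analysis.Analysis"
    "HOL-Computational_Algebra.Polynomial"
    "HOL-Library.Discrete_Functions"
begin

section \<open>The space of square-summable real sequences\<close>

text \<open>Sequences are indexed from 0: the coordinate with index \<open>n\<close> is the one the
  mathematics calls \<open>c\<^sub>i\<close> with \<open>i = n + 1\<close>. The same shift applies to the Haar functions.\<close>

typedef ell2 = "{c :: nat \<Rightarrow> real. summable (\<lambda>n. (c n)\<^sup>2)}"
  morphisms coord Abs_ell2
  by (rule exI[of _ "\<lambda>_. 0"]) simp

setup_lifting type_definition_ell2

lemma summable_coord_sq: "summable (\<lambda>n. (coord c n)\<^sup>2)"
  using coord[of c] by simp

lemma square_summable_mult:
  fixes a b :: "nat \<Rightarrow> real"
  assumes "summable (\<lambda>n. (a n)\<^sup>2)" "summable (\<lambda>n. (b n)\<^sup>2)"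
  shows "summable (\<lambda>n. a n * b n)"
proof (rule summable_comparison_test')
  show "summable (\<lambda>n. (a n)\<^sup>2 + (b n)\<^sup>2)"
    using assms by (rule summable_add)
  show "norm (a n * b n) \<le> (a n)\<^sup>2 + (b n)\<^sup>2" if "n \<ge> 0" for n
  proof -
    have "2 * (\<bar>a n\<bar> * \<bar>b n\<bar>) \<le> (a n)\<^sup>2 + (b n)\<^sup>2"
      using sum_squares_bound[of "\<bar>a n\<bar>" "\<bar>b n\<bar>"] by simp
    moreover have "0 \<le> \<bar>a n\<bar> * \<bar>b n\<bar>" by simp
    ultimately show ?thesis unfolding real_norm_def abs_mult by linarith
  qed
qed

lemma square_summable_add:
  fixes a b :: "nat \<Rightarrow> real"
  assumes "summable (\<lambda>n. (a n)\<^sup>2)" "summable (\<lambda>n. (b n)\<^sup>2)"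
  shows "summable (\<lambda>n. (a n + b n)\<^sup>2)"
proof -
  have "summable (\<lambda>n. (a n)\<^sup>2 + (b n)\<^sup>2 + 2 * (a n * b n))"
    using assms by (intro summable_add summable_mult square_summable_mult)
  then show ?thesis by (simp add: power2_sum mult.assoc)
qed

lemma square_summable_scale:
  fixes a :: "nat \<Rightarrow> real"
  assumes "summable (\<lambda>n. (a n)\<^sup>2)"
  shows "summable (\<lambda>n. (r * a n)\<^sup>2)"
  using summable_mult[OF assms, of "r\<^sup>2"] by (simp add: power_mult_distrib)

instantiation ell2 :: real_inner
begin

lift_definition zero_ell2 :: ell2 is "\<lambda>_. 0" by simp

lift_definition plus_ell2 :: "ell2 \<Rightarrow> ell2 \<Rightarrow> ell2" is "\<lambda>a b n. a n + b n"
  by (rule square_summable_add)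

lift_definition uminus_ell2 :: "ell2 \<Rightarrow> ell2" is "\<lambda>a n. - a n" by simp

lift_definition minus_ell2 :: "ell2 \<Rightarrow> ell2 \<Rightarrow> ell2" is "\<lambda>a b n. a n - b n"
  using square_summable_add[of _ "\<lambda>n. - _ n"] by simp

lift_definition scaleR_ell2 :: "real \<Rightarrow> ell2 \<Rightarrow> ell2" is "\<lambda>r a n. r * a n"
  by (rule square_summable_scale)

lift_definition inner_ell2 :: "ell2 \<Rightarrow> ell2 \<Rightarrow> real" is "\<lambda>a b. \<Sum>n. a n * b n" .

definition norm_ell2 :: "ell2 \<Rightarrow> real" where "norm_ell2 c = sqrt (inner c c)"

definition dist_ell2 :: "ell2 \<Rightarrow> ell2 \<Rightarrow> real" where "dist_ell2 a b = norm (a - b)"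

definition sgn_ell2 :: "ell2 \<Rightarrow> ell2" where "sgn_ell2 c = inverse (norm c) *\<^sub>R c"

definition uniformity_ell2 :: "(ell2 \<times> ell2) filter" where
  "uniformity_ell2 = (INF e\<in>{0 <..}. principal {(x, y). dist x y < e})"

definition open_ell2 :: "ell2 set \<Rightarrow> bool" where
  "open_ell2 U \<longleftrightarrow> (\<forall>x\<in>U. \<forall>\<^sub>F (x', y) in uniformity. x' = x \<longrightarrow> y \<in> U)"

instance
proof
  fix a b c :: ell2 and r s :: real
  show "a + b + c = a + (b + c)" by transfer (simp add: add.assoc)
  show "a + b = b + a" by transfer (simp add: add.commute)
  show "0 + a = a" by transfer simp
  show "- a + a = 0" by transfer simp
  show "a - b = a + - b" by transfer simp
  show "r *\<^sub>R (a + b) = r *\<^sub>R a + r *\<^sub>R b" by transfer (simp add: distrib_left)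
  show "(r + s) *\<^sub>R a = r *\<^sub>R a + s *\<^sub>R a" by transfer (simp add: distrib_right)
  show "r *\<^sub>R s *\<^sub>R a = (r * s) *\<^sub>R a" by transfer (simp add: mult.assoc)
  show "1 *\<^sub>R a = a" by transfer simp
  show "inner a b = inner b a" by transfer (simp add: mult.commute)
  show "inner (a + b) c = inner a c + inner b c"
    by transfer (simp add: distrib_right suminf_add square_summable_mult)
  show "inner (r *\<^sub>R a) b = r * inner a b"
    by transfer (simp add: mult.assoc suminf_mult square_summable_mult)
  show "0 \<le> inner a a"
    by transfer (simp add: suminf_nonneg square_summable_mult)
  show "(inner a a = 0) = (a = 0)"
  proof transfer
    fix a :: "nat \<Rightarrow> real"
    assume "summable (\<lambda>n. (a n)\<^sup>2)"
    then have "(\<Sum>n. a n * a n) = 0 \<longleftrightarrow> (\<forall>n. a n * a n = 0)"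
      by (intro suminf_eq_zero_iff square_summable_mult) auto
    then show "((\<Sum>n. a n * a n) = 0) = (a = (\<lambda>_. 0))"
      by (auto simp: fun_eq_iff)
  qed
  show "norm a = sqrt (inner a a)" by (rule norm_ell2_def)
  show "dist a b = norm (a - b)" by (rule dist_ell2_def)
  show "sgn a = inverse (norm a) *\<^sub>R a" by (rule sgn_ell2_def)
next
  show "uniformity = (INF e\<in>{0 <..}. principal {(x :: ell2, y). dist x y < e})"
    by (rule uniformity_ell2_def)
next
  fix U :: "ell2 set"
  show "open U = (\<forall>x\<in>U. \<forall>\<^sub>F (x', y) in uniformity. x' = x \<longrightarrow> y \<in> U)"
    by (rule open_ell2_def)
qed

end

lemma norm_ell2_eq: "norm c = sqrt (\<Sum>n. (coord c n)\<^sup>2)"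
  by (simp add: norm_ell2_def inner_ell2.rep_eq power2_eq_square)

lift_definition proj_fin :: "nat \<Rightarrow> ell2 \<Rightarrow> ell2" is "\<lambda>M c n. if n < M then c n else 0"
  by (rule summable_finite[of "{..<_}"]) auto

definition proj_tail :: "nat \<Rightarrow> ell2 \<Rightarrow> ell2" where
  "proj_tail M c = c - proj_fin M c"

text \<open>\<open>\<real>\<^sup>M\<close>, identified with the sequences that vanish from index \<open>M\<close> on.\<close>

definition RM :: "nat \<Rightarrow> ell2 set" where
  "RM M = {c. \<forall>n\<ge>M. coord c n = 0}"

text \<open>The values of \<open>A\<close> outside of \<open>\<real>\<^sup>M\<close> are left arbitrary.\<close>

definition linear_RM :: "nat \<Rightarrow> (ell2 \<Rightarrow> ell2) \<Rightarrow> bool" where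
  "linear_RM M A \<longleftrightarrow>
     (\<forall>x\<in>RM M. A x \<in> RM M) \<and>
     (\<forall>x\<in>RM M. \<forall>y\<in>RM M. A (x + y) = A x + A y) \<and>
     (\<forall>r. \<forall>x\<in>RM M. A (r *\<^sub>R x) = r *\<^sub>R A x)"


section \<open>Haar wavelets and the Haar transform\<close>

definition haar_psi :: "nat \<Rightarrow> nat \<Rightarrow> real \<Rightarrow> real" where
  "haar_psi j k t =
     (if real k / 2 ^ j \<le> t \<and> t < (real k + 1 / 2) / 2 ^ j then sqrt (2 ^ j)
      else if (real k + 1 / 2) / 2 ^ j \<le> t \<and> t < (real k + 1) / 2 ^ j then - sqrt (2 ^ j)
      else 0)"

text \<open>With indices starting at 0, \<open>\<psi>\<^sub>j\<^sub>,\<^sub>k\<close> is the function with index \<open>2 ^ j + k\<close>, so that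
  \<open>j\<close> is the integer part of the binary logarithm of the index.\<close>

definition haar :: "nat \<Rightarrow> real \<Rightarrow> real" where
  "haar n = (if n = 0 then indicator {0..<1}
             else haar_psi (floor_log n) (n - 2 ^ floor_log n))"

lemma haar_0: "haar 0 = indicator {0..<1}"
  by (simp add: haar_def)

lemma haar_dyadic:
  assumes "k < 2 ^ j"
  shows "haar (2 ^ j + k) = haar_psi j k"
proof -
  have "floor_log (2 ^ j + k) = j"
    using assms by (intro floor_log_eqI) auto
  then show ?thesis by (simp add: haar_def)
qed

definition haar_prim :: "nat \<Rightarrow> real \<Rightarrow> real" where
  "haar_prim n t = (LINT s|lebesgue_on {0..t}. haar n s)"

definition L2_unit :: "(real \<Rightarrow> real) set" where
  "L2_unit = {g \<in> borel_measurable (lebesgue_on {0..1}).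
                integrable (lebesgue_on {0..1}) (\<lambda>t. (g t)\<^sup>2)}"

text \<open>The coefficient sequence is square-summable for \<open>g\<close> in \<open>L\<^sup>2([0,1])\<close>, by Bessel's
  inequality; the transform is only meaningful for such \<open>g\<close>.\<close>

definition haar_transform :: "(real \<Rightarrow> real) \<Rightarrow> ell2" where
  "haar_transform g = Abs_ell2 (\<lambda>n. LINT t|lebesgue_on {0..1}. g t * haar n t)"


section \<open>The maps attached to the initial value problem\<close>

text \<open>The series \<open>\<Sum>n. coord c n * haar_prim n t\<close> converges absolutely for all \<open>t\<close> in \<open>[0,1]\<close>:
  by Parseval, the squares of the \<open>haar_prim n t\<close> have sum \<open>t\<close>.\<close>

definition ivp_rhs :: "(real \<Rightarrow> real \<Rightarrow> real) \<Rightarrow> real \<Rightarrow> ell2 \<Rightarrow> real \<Rightarrow> real" where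
  "ivp_rhs f u0 c t = f t ((\<Sum>n. coord c n * haar_prim n t) + u0)"

definition ivp_map :: "(real \<Rightarrow> real \<Rightarrow> real) \<Rightarrow> real \<Rightarrow> ell2 \<Rightarrow> ell2" where
  "ivp_map f u0 c = c - haar_transform (ivp_rhs f u0 c)"

definition newton_map :: "nat \<Rightarrow> (ell2 \<Rightarrow> ell2) \<Rightarrow> (ell2 \<Rightarrow> ell2) \<Rightarrow> ell2 \<Rightarrow> ell2" where
  "newton_map M A F x = proj_fin M x - A (proj_fin M (F x)) + proj_tail M (x - F x)"

definition open_box :: "nat \<Rightarrow> real \<Rightarrow> ell2 \<Rightarrow> real \<Rightarrow> ell2 set" where
  "open_box M \<omega> c r =
     {y. norm (proj_fin M (y - c)) < \<omega> * r \<and> norm (proj_tail M (y - c)) < (1 - \<omega>) * r}"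

text \<open>The polynomial \<open>Z(r) r - \<sigma> r + Y\<close>; the weight \<open>\<sigma>\<close> is \<open>\<omega>\<close> for the finite part and
  \<open>1 - \<omega>\<close> for the tail.\<close>

definition radii_poly :: "real poly \<Rightarrow> real \<Rightarrow> real \<Rightarrow> real poly" where
  "radii_poly Z \<sigma> Y = Z * [:0, 1:] - [:0, \<sigma>:] + [:Y:]"

lemma poly_radii_poly: "poly (radii_poly Z \<sigma> Y) r = poly Z r * r - \<sigma> * r + Y"
  by (simp add: radii_poly_def algebra_simps)

end

theory Submission
  imports Defs
begin

text \<open>The bounds on \<open>DT\<close> over all directions of norm at most \<open>r\<^sub>0\<close> are bounds on operator
  norms, so by the mean value inequality \<open>\<Pi>\<^sub>M T\<close> and \<open>\<Pi>\<^sub>\<infinity> T\<close> are Lipschitz on the ball of radius \<open>r\<^sub>0\<close> around the centre,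
  with constants \<open>Z\<^sub>M(r\<^sub>0)\<close> and \<open>Z\<^sub>\<infinity>(r\<^sub>0)\<close>. The two radii inequalities add up to
  \<open>Z\<^sub>M(r\<^sub>0) + Z\<^sub>\<infinity>(r\<^sub>0) < 1\<close>, which makes \<open>T\<close> a contraction in the \<open>\<ell>\<^sup>2\<close> norm itself, and each of
  them separately shows that \<open>T\<close> maps the closed box into the open one. Hence Banach's fixed point
  theorem applies on the closed box, and the fixed point lies in the open box.\<close>

section \<open>Completeness of \<open>ell2\<close>, which the fixed point theorem requires\<close>

lemma sum_coord_sq_le: "(\<Sum>n<K. (coord c n)\<^sup>2) \<le> (norm c)\<^sup>2"
proof -
  have "(\<Sum>n<K. (coord c n)\<^sup>2) \<le> (\<Sum>n. (coord c n)\<^sup>2)"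
    by (intro sum_le_suminf summable_coord_sq) auto
  also have "\<dots> = (norm c)\<^sup>2"
    by (simp add: norm_ell2_eq suminf_nonneg summable_coord_sq)
  finally show ?thesis .
qed

lemma abs_coord_le_norm: "\<bar>coord c n\<bar> \<le> norm c"
proof -
  have "(coord c n)\<^sup>2 \<le> (\<Sum>i<Suc n. (coord c i)\<^sup>2)"
    by (simp add: sum_nonneg)
  also have "\<dots> \<le> (norm c)\<^sup>2"
    by (rule sum_coord_sq_le)
  finally show ?thesis
    using abs_le_square_iff[of "coord c n" "norm c"] by simp
qed

lemma bounded_linear_coord: "bounded_linear (\<lambda>c. coord c n)"
proof (rule bounded_linear_intro[where K = 1])
  show "coord (x + y) n = coord x n + coord y n" for x y
    by (simp add: plus_ell2.rep_eq)
  show "coord (r *\<^sub>R x) n = r *\<^sub>R coord x n" for r x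
    by (simp add: scaleR_ell2.rep_eq)
  show "norm (coord x n) \<le> norm x * 1" for x
    by (simp add: abs_coord_le_norm)
qed

lemma coord_minus: "coord (a - b) n = coord a n - coord b n"
  by (simp add: minus_ell2.rep_eq)

text \<open>A Cauchy sequence converges in each coordinate, since coordinates are bounded
  functionals. Cauchy bounds on finite partial sums survive this limit with a constant independent
  of the number of terms, which gives both square-summability of the limit and convergence in
  norm.\<close>

instance ell2 :: banach
proof
  fix X :: "nat \<Rightarrow> ell2"
  assume X: "Cauchy X"
  define a where "a n = lim (\<lambda>m. coord (X m) n)" for n
  have a: "(\<lambda>m. coord (X m) n) \<longlonglongrightarrow> a n" for n
    using bounded_linear.Cauchy[OF bounded_linear_coord X]
    by (simp add: a_def Cauchy_convergent_iff convergent_LIMSEQ_iff)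
  have tail: "(\<Sum>n<K. (coord (X m) n - a n)\<^sup>2) \<le> e\<^sup>2"
    if N: "\<And>m k. m \<ge> N \<Longrightarrow> k \<ge> N \<Longrightarrow> norm (X m - X k) < e" and "m \<ge> N" for N m K e
  \<comment> \<open>The index \<open>k\<close> tends to infinity while \<open>m\<close> and the
    finite range \<open>K\<close> stay fixed.\<close>
  proof (rule LIMSEQ_le_const2)
    show "(\<lambda>k. \<Sum>n<K. (coord (X m) n - coord (X k) n)\<^sup>2) \<longlonglongrightarrow> (\<Sum>n<K. (coord (X m) n - a n)\<^sup>2)"
      by (intro tendsto_intros a)
    have "(\<Sum>n<K. (coord (X m) n - coord (X k) n)\<^sup>2) \<le> e\<^sup>2" if "k \<ge> N" for k
    proof -
      have "(\<Sum>n<K. (coord (X m) n - coord (X k) n)\<^sup>2) \<le> (norm (X m - X k))\<^sup>2"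
        using sum_coord_sq_le[of "X m - X k" K] by (simp add: coord_minus)
      also have "\<dots> \<le> e\<^sup>2"
        using N[OF \<open>m \<ge> N\<close> that] by (intro power_mono) auto
      finally show ?thesis .
    qed
    then show "\<exists>N. \<forall>k\<ge>N. (\<Sum>n<K. (coord (X m) n - coord (X k) n)\<^sup>2) \<le> e\<^sup>2"
      by blast
  qed
  have diff_summable: "summable (\<lambda>n. (coord (X m) n - a n)\<^sup>2)"
    if "\<And>m k. m \<ge> N \<Longrightarrow> k \<ge> N \<Longrightarrow> norm (X m - X k) < e" and "m \<ge> N" for N m e
    by (rule summableI_nonneg_bounded[where x = "e\<^sup>2"]) (use tail[OF that] in auto)
  have cauchy: "\<exists>N. \<forall>m\<ge>N. \<forall>k\<ge>N. norm (X m - X k) < e" if "e > 0" for e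
    using X that by (simp add: Cauchy_iff)
  obtain N where N: "\<And>m k. m \<ge> N \<Longrightarrow> k \<ge> N \<Longrightarrow> norm (X m - X k) < 1"
    using cauchy[of 1] by auto
  \<comment> \<open>This writes \<open>a\<close> as \<open>X N\<close> minus the square-summable
    difference; the factor -1 fits the scaling lemma.\<close>
  have "summable (\<lambda>n. (coord (X N) n + (-1) * (coord (X N) n - a n))\<^sup>2)"
    by (intro square_summable_add square_summable_scale summable_coord_sq diff_summable[OF N]) auto
  then have "summable (\<lambda>n. (a n)\<^sup>2)"
    by simp
  then have coord_lim: "coord (Abs_ell2 a) = a"
    by (intro Abs_ell2_inverse) simp
  have "X \<longlonglongrightarrow> Abs_ell2 a"
  proof (rule LIMSEQ_I)
    fix r :: real
    assume "r > 0"
    then obtain N where N: "\<And>m k. m \<ge> N \<Longrightarrow> k \<ge> N \<Longrightarrow> norm (X m - X k) < r / 2"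
      using cauchy[of "r / 2"] by auto
    have "norm (X m - Abs_ell2 a) < r" if "m \<ge> N" for m
    proof -
      have "(\<Sum>n. (coord (X m) n - a n)\<^sup>2) \<le> (r / 2)\<^sup>2"
        by (intro suminf_le_const diff_summable[OF N that] tail[OF N that]) auto
      then have "norm (X m - Abs_ell2 a) \<le> r / 2"
        using \<open>r > 0\<close> unfolding norm_ell2_eq coord_minus coord_lim by (intro real_le_lsqrt) auto
      then show ?thesis
        using \<open>r > 0\<close> by simp
    qed
    then show "\<exists>N. \<forall>m\<ge>N. norm (X m - Abs_ell2 a) < r"
      by blast
  qed
  then show "convergent X"
    by (rule convergentI)
qed

section \<open>Projections and differentiability of the Newton-like map\<close>

lemma norm_proj_fin_le: "norm (proj_fin M c) \<le> norm c"
  unfolding norm_ell2_eq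
  by (intro real_sqrt_le_mono suminf_le summable_coord_sq) (auto simp: proj_fin.rep_eq)

lemma bounded_linear_proj_fin: "bounded_linear (proj_fin M)"
proof (rule bounded_linear_intro[where K = 1])
  show "proj_fin M (x + y) = proj_fin M x + proj_fin M y" for x y
    by transfer auto
  show "proj_fin M (r *\<^sub>R x) = r *\<^sub>R proj_fin M x" for r x
    by transfer auto
  show "norm (proj_fin M x) \<le> norm x * 1" for x
    by (simp add: norm_proj_fin_le)
qed

lemma bounded_linear_proj_tail: "bounded_linear (proj_tail M)"
  unfolding proj_tail_def
  by (intro bounded_linear_sub bounded_linear_ident bounded_linear_proj_fin)

lemma norm_le_proj_parts: "norm c \<le> norm (proj_fin M c) + norm (proj_tail M c)"
  using norm_triangle_ineq[of "proj_fin M c" "proj_tail M c"] by (simp add: proj_tail_def)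

lift_definition unit_seq :: "nat \<Rightarrow> ell2" is "\<lambda>i n. if n = i then 1 else 0"
  by (rule summable_finite[of "{_}"]) auto

lemma proj_fin_Suc: "proj_fin (Suc M) c = proj_fin M c + coord c M *\<^sub>R unit_seq M"
  by transfer (auto simp: less_Suc_eq)

text \<open>Induction on \<open>K\<close> peels off one basis vector at a time. As \<open>A\<close>
  is linear only on \<open>RM M\<close>, the bound \<open>K \<le> M\<close> keeps every vector
  involved inside that subspace.\<close>

lemma linear_RM_proj_fin:
  assumes A: "linear_RM M A" and "K \<le> M"
  shows "A (proj_fin K c) = (\<Sum>i<K. coord c i *\<^sub>R A (unit_seq i))"
  using \<open>K \<le> M\<close>
proof (induction K)
  case 0
  \<comment> \<open>Homogeneity with scalar 0 yields \<open>A 0 = 0\<close>.\<close>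
  have "proj_fin 0 c = 0 *\<^sub>R (0 :: ell2)"
    by transfer simp
  moreover have "(0 :: ell2) \<in> RM M"
    by (simp add: RM_def zero_ell2.rep_eq)
  then have "A (0 *\<^sub>R 0) = 0 *\<^sub>R A 0"
    using A unfolding linear_RM_def by blast
  ultimately show ?case
    by simp
next
  case (Suc K)
  have "proj_fin K c \<in> RM M" "unit_seq K \<in> RM M" "coord c K *\<^sub>R unit_seq K \<in> RM M"
    using Suc.prems by (auto simp: RM_def proj_fin.rep_eq unit_seq.rep_eq scaleR_ell2.rep_eq)
  then show ?case
    using A Suc by (simp add: linear_RM_def proj_fin_Suc)
qed

text \<open>Continuity is automatic in finite dimension: the basis expansion is a finite sum of
  bounded coordinate functionals times fixed vectors.\<close>

lemma bounded_linear_RM_proj_fin: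
  assumes "linear_RM M A"
  shows "bounded_linear (\<lambda>c. A (proj_fin M c))"
proof -
  have "bounded_linear (\<lambda>c. \<Sum>i<M. coord c i *\<^sub>R A (unit_seq i))"
    by (intro bounded_linear_sum bounded_linear_scaleR_const bounded_linear_coord)
  then show ?thesis
    using linear_RM_proj_fin[OF assms] by simp
qed

lemma differentiable_newton_map:
  assumes "linear_RM M A" "F differentiable (at c)"
  shows "newton_map M A F differentiable (at c)"
proof -
  obtain F' where F': "(F has_derivative F') (at c)"
    using assms(2) by (auto simp: differentiable_def)
  have "((\<lambda>x. proj_fin M x - A (proj_fin M (F x)) + proj_tail M (x - F x)) has_derivative
      (\<lambda>h. proj_fin M h - A (proj_fin M (F' h)) + proj_tail M (h - F' h))) (at c)"
    by (intro has_derivative_add has_derivative_diff has_derivative_ident F'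
        bounded_linear.has_derivative[OF bounded_linear_proj_fin]
        bounded_linear.has_derivative[OF bounded_linear_proj_tail]
        bounded_linear.has_derivative[OF bounded_linear_RM_proj_fin[OF assms(1)]])
  then show ?thesis
    unfolding differentiable_def newton_map_def by blast
qed

section \<open>From derivative bounds to Lipschitz bounds\<close>

lemma nonneg_of_SUP_norm_le:
  fixes g :: "'a::real_normed_vector \<Rightarrow> 'b::real_normed_vector \<Rightarrow> 'c::real_normed_vector"
  assumes "r > 0"
    and Z: "(SUP (x1, x2) \<in> cball 0 r \<times> cball 0 r. ereal (norm (g x1 x2))) \<le> ereal (Z * r)"
  shows "Z \<ge> 0"
proof -
  have "(0, 0) \<in> cball (0::'a) r \<times> cball (0::'b) r"
    using \<open>r > 0\<close> by simp
  from order_trans[OF SUP_upper[OF this] Z] have "norm (g 0 0) \<le> Z * r"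
    by simp
  from order_trans[OF norm_ge_zero this] show ?thesis
    using \<open>r > 0\<close> by (simp add: zero_le_mult_iff)
qed

text \<open>Homogeneity in the direction turns the supremum over directions of norm at most
  \<open>r\<close> into an operator norm bound \<open>Z\<close> at each point of the ball; the ball
  is convex, so the mean value inequality applies. The supremum lives in \<open>ereal\<close>, so
  the hypothesis includes its finiteness.\<close>

lemma Lipschitz_of_SUP_derivative:
  fixes T :: "'a::real_normed_vector \<Rightarrow> 'b::real_normed_vector"
    and P :: "'b \<Rightarrow> 'c::real_normed_vector"
  assumes P: "bounded_linear P"
    and T: "\<And>x. T differentiable (at x)"
    and "r > 0"
    and Z: "(SUP (x1, x2) \<in> cball 0 r \<times> cball 0 r.
        ereal (norm (P (frechet_derivative T (at (c + x1)) x2)))) \<le> ereal (Z * r)"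
    and "x \<in> cball c r" "y \<in> cball c r"
  shows "norm (P (T x - T y)) \<le> Z * norm (x - y)"
proof -
  interpret P: bounded_linear P by (rule P)
  let ?D = "\<lambda>x. frechet_derivative T (at x)"
  have D: "(T has_derivative ?D x) (at x)" for x
    using T frechet_derivative_works by blast
  have linear_D: "linear (?D x)" for x
    using D by (rule has_derivative_linear)
  have bound: "norm (P (?D z h)) \<le> Z * norm h" if z: "z \<in> cball c r" for z h
  proof (cases "h = 0")
    case True
    then show ?thesis
      by (simp add: linear_0[OF linear_D] P.zero)
  next
    case False
    \<comment> \<open>Scaling by \<open>s\<close> moves \<open>h\<close> to the sphere of radius
      \<open>r\<close>, where the hypothesis can be used with \<open>x1 = z - c\<close>.\<close>
    define s where "s = r / norm h"
    have "s > 0"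
      using False \<open>r > 0\<close> by (simp add: s_def)
    have "(z - c, s *\<^sub>R h) \<in> cball 0 r \<times> cball 0 r"
      using z False \<open>r > 0\<close> by (simp add: s_def dist_norm norm_minus_commute)
    from order_trans[OF SUP_upper[OF this] Z] have "norm (P (?D z (s *\<^sub>R h))) \<le> Z * r"
      by simp
    moreover have "?D z (s *\<^sub>R h) = s *\<^sub>R ?D z h"
      by (rule linear_scale[OF linear_D])
    ultimately have "s * norm (P (?D z h)) \<le> Z * r"
      using \<open>s > 0\<close> by (simp add: P.scaleR)
    also have "Z * r = s * (Z * norm h)"
      using False by (simp add: s_def)
    finally have "s * norm (P (?D z h)) \<le> s * (Z * norm h)" .
    then show ?thesis
      using \<open>s > 0\<close> by simp
  qed
  have "norm (P (T x) - P (T y)) \<le> Z * norm (x - y)"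
  proof (rule differentiable_bound[where S = "cball c r"])
    show "((\<lambda>x. P (T x)) has_derivative (\<lambda>h. P (?D z h))) (at z within cball c r)" for z
      by (intro P.has_derivative has_derivative_at_withinI[OF D])
    show "onorm (\<lambda>h. P (?D z h)) \<le> Z" if "z \<in> cball c r" for z
    proof (rule onorm_bound)
      show "0 \<le> Z"
        using \<open>r > 0\<close> Z by (rule nonneg_of_SUP_norm_le)
    qed (rule bound[OF that])
  qed (use \<open>x \<in> cball c r\<close> \<open>y \<in> cball c r\<close> in simp_all)
  then show ?thesis
    by (simp only: P.diff)
qed

theorem theorem3p1:
  fixes f :: "real \<Rightarrow> real \<Rightarrow> real" and u0 :: real
    and J M :: nat and \<omega> :: real
    and F A T :: "ell2 \<Rightarrow> ell2" and cbar :: ell2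
    and Y_M Y_inf :: real and Z_M Z_inf p_M p_inf :: "real poly"
    and r0 :: real
  assumes M: "M = 2 ^ (J + 1)"
    and \<omega>: "0 < \<omega>" "\<omega> < 1"
    and F: "F = ivp_map f u0"
    and F_well_defined: "\<And>c. ivp_rhs f u0 c \<in> L2_unit"
    and F_differentiable: "\<And>c. F differentiable (at c)"
    and A: "linear_RM M A"
    and T: "T = newton_map M A F"
    and cbar: "cbar \<in> RM M"
    and Y_M: "norm (proj_fin M (T cbar - cbar)) \<le> Y_M"
    and Y_inf: "norm (proj_tail M (T cbar - cbar)) \<le> Y_inf"
    and Z_M: "\<And>r. r > 0 \<Longrightarrow>
      (SUP (x1, x2) \<in> cball 0 r \<times> cball 0 r.
         ereal (norm (proj_fin M (frechet_derivative T (at (cbar + x1)) x2))))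
      \<le> ereal (poly Z_M r * r)"
    and Z_inf: "\<And>r. r > 0 \<Longrightarrow>
      (SUP (x1, x2) \<in> cball 0 r \<times> cball 0 r.
         ereal (norm (proj_tail M (frechet_derivative T (at (cbar + x1)) x2))))
      \<le> ereal (poly Z_inf r * r)"
    and p_M: "p_M = radii_poly Z_M \<omega> Y_M"
    and p_inf: "p_inf = radii_poly Z_inf (1 - \<omega>) Y_inf"
    and r0: "r0 > 0" "poly p_M r0 < 0" "poly p_inf r0 < 0"
  shows "\<exists>!c. c \<in> open_box M \<omega> cbar r0 \<and> T c = c"
proof -
  \<comment> \<open>The closed version of the box is complete, unlike the open one.\<close>
  define B where "B = {y. norm (proj_fin M (y - cbar)) \<le> \<omega> * r0 \<and>
    norm (proj_tail M (y - cbar)) \<le> (1 - \<omega>) * r0}"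
  define zM where "zM = poly Z_M r0"
  define zI where "zI = poly Z_inf r0"
  have T_diff: "T differentiable (at x)" for x
    unfolding T by (rule differentiable_newton_map[OF A F_differentiable])
  note lip_fin = Lipschitz_of_SUP_derivative[OF bounded_linear_proj_fin T_diff r0(1) Z_M[OF r0(1)],
      folded zM_def]
  note lip_tail = Lipschitz_of_SUP_derivative[OF bounded_linear_proj_tail T_diff r0(1) Z_inf[OF r0(1)],
      folded zI_def]
  have cont_fin: "continuous_on UNIV (\<lambda>y. norm (proj_fin M (y - cbar)))"
    by (intro continuous_intros bounded_linear.continuous_on[OF bounded_linear_proj_fin])
  have cont_tail: "continuous_on UNIV (\<lambda>y. norm (proj_tail M (y - cbar)))"
    by (intro continuous_intros bounded_linear.continuous_on[OF bounded_linear_proj_tail])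
  \<comment> \<open>The weights \<open>\<omega>\<close> and \<open>1 - \<omega>\<close> sum to 1, so
    the box lies in the ball on which the derivative bounds hold.\<close>
  have norm_B: "norm (y - cbar) \<le> r0" if "y \<in> B" for y
    using norm_le_proj_parts[of "y - cbar" M] that by (simp add: B_def algebra_simps)
  then have B_cball: "B \<subseteq> cball cbar r0"
    by (auto simp: dist_norm norm_minus_commute)
  have cbar_cball: "cbar \<in> cball cbar r0"
    using r0(1) by simp
  have zM_r0: "zM * r0 + Y_M < \<omega> * r0" and zI_r0: "zI * r0 + Y_inf < (1 - \<omega>) * r0"
    using r0(2,3) by (simp_all add: p_M p_inf poly_radii_poly zM_def zI_def)
  have Y_nonneg: "Y_M \<ge> 0" "Y_inf \<ge> 0"
    using order_trans[OF norm_ge_zero Y_M] order_trans[OF norm_ge_zero Y_inf] by auto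
  have z_nonneg: "zM \<ge> 0" "zI \<ge> 0"
    unfolding zM_def zI_def
    by (rule nonneg_of_SUP_norm_le[OF r0(1) Z_M[OF r0(1)]])
      (rule nonneg_of_SUP_norm_le[OF r0(1) Z_inf[OF r0(1)]])
  have "(zM + zI) * r0 < 1 * r0"
    using zM_r0 zI_r0 Y_nonneg by (simp add: algebra_simps)
  then have z_less_1: "zM + zI < 1"
    using r0(1) mult_less_cancel_right_pos by blast
  have contraction: "dist (T x) (T y) \<le> (zM + zI) * dist x y" if "x \<in> B" "y \<in> B" for x y
  proof -
    have "x \<in> cball cbar r0" "y \<in> cball cbar r0"
      using that B_cball by auto
    from lip_fin[OF this] lip_tail[OF this] show ?thesis
      using norm_le_proj_parts[of "T x - T y" M] by (simp add: dist_norm distrib_right)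
  qed
  have into_open: "T y \<in> open_box M \<omega> cbar r0" if "y \<in> B" for y
  proof -
    \<comment> \<open>Inserting \<open>T cbar\<close> separates the Lipschitz part, at most
      \<open>zM * r0\<close> or \<open>zI * r0\<close>, from the defect at the centre, bounded by
      \<open>Y_M\<close> or \<open>Y_inf\<close>.\<close>
    have split: "T y - cbar = (T y - T cbar) + (T cbar - cbar)"
      by simp
    have y: "y \<in> cball cbar r0"
      using that B_cball by blast
    have "norm (proj_fin M (T y - cbar)) \<le>
        norm (proj_fin M (T y - T cbar)) + norm (proj_fin M (T cbar - cbar))"
      unfolding split linear_add[OF bounded_linear.linear[OF bounded_linear_proj_fin]]
      by (rule norm_triangle_ineq)
    also have "\<dots> \<le> zM * r0 + Y_M"
      using lip_fin[OF y cbar_cball] mult_left_mono[OF norm_B[OF that] z_nonneg(1)] Y_M by linarith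
    finally have fin: "norm (proj_fin M (T y - cbar)) < \<omega> * r0"
      using zM_r0 by simp
    have "norm (proj_tail M (T y - cbar)) \<le>
        norm (proj_tail M (T y - T cbar)) + norm (proj_tail M (T cbar - cbar))"
      unfolding split linear_add[OF bounded_linear.linear[OF bounded_linear_proj_tail]]
      by (rule norm_triangle_ineq)
    also have "\<dots> \<le> zI * r0 + Y_inf"
      using lip_tail[OF y cbar_cball] mult_left_mono[OF norm_B[OF that] z_nonneg(2)] Y_inf by linarith
    finally have "norm (proj_tail M (T y - cbar)) < (1 - \<omega>) * r0"
      using zI_r0 by simp
    with fin show ?thesis
      by (simp add: open_box_def)
  qed
  have open_B: "open_box M \<omega> cbar r0 \<subseteq> B"
    by (auto simp: open_box_def B_def)
  have "\<exists>!c\<in>B. T c = c"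
  proof (rule Banach_fix)
    have "closed B"
      unfolding B_def by (intro closed_Collect_conj closed_Collect_le cont_fin cont_tail continuous_on_const)
    then show "complete B"
      by (simp add: complete_eq_closed)
    have "cbar \<in> B"
      using \<omega> r0(1) bounded_linear_proj_fin[of M] bounded_linear_proj_tail[of M]
      by (simp add: B_def linear_0 bounded_linear.linear)
    then show "B \<noteq> {}"
      by blast
    show "T ` B \<subseteq> B"
      using into_open open_B by blast
  qed (use z_nonneg z_less_1 contraction in auto)
  then obtain c where "c \<in> B" "T c = c" and unique: "\<And>x. x \<in> B \<Longrightarrow> T x = x \<Longrightarrow> x = c"
    by blast
  \<comment> \<open>The fixed point equals its own image under \<open>T\<close>, hence lies in the
    open box; uniqueness is inherited from the larger set \<open>B\<close>.\<close>
  show ?thesis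
  proof (rule ex1I)
    show "c \<in> open_box M \<omega> cbar r0 \<and> T c = c"
      using into_open[OF \<open>c \<in> B\<close>] \<open>T c = c\<close> by simp
    show "x = c" if "x \<in> open_box M \<omega> cbar r0 \<and> T x = x" for x
      using unique that open_B by blast
  qed
qed

end
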